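(* Let $\mathbb{F}_q$ be a finite field and $n\ge 1$. There exists a finite set $B$ of polynomial constraints over $\mathbb{F}_q[x_1,\dots,x_n]$ such that for every explanation function $\mathrm{exp}$ there is an explanation function $\mathrm{exp}'$ defined on the same inputs such that for every input $(f,M)$, every literal of $\mathrm{exp}'(f,M)$ other than $f$ and other than negations of constraints on $M$ belongs to $B$ (i.e. $\mathrm{exp}'$ is a finite basis explanation function).
   Context: Variables $x_1<\dots<x_n$, $X_k=\{x_1,\dots,x_k\}$. A polynomial constraint is $p=0$ or $p\neq 0$ with $p\in\mathbb{F}_q[x_1,\dots,x_n]$; negation swaps $=$ and $\neq$; a clause is a set of constraints read as a disjunction. The level of a constraint is the largest $i$ with $x_i$ occurring in it. A trail $M$ of level $k$ is a sequence of polynomial constraints (with polynomials in $\mathbb{F}_q[X_k]$) and variable assignments, whose variable assignments are exactly $x_1\mapsto\alpha_1,\dots,x_{k-1}\mapsto\alpha_{k-1}$ ($\alpha_i\in\mathbb{F}_q$), defining the partial assignment $\nu_M$; $\mathrm{constraints}(M)$ is the set of constraints on $M$. For a constraint $g$ with polynomial in $\mathbb{F}_q[X_k]$: $\mathrm{value}(g,M)=\nu_M(g)$ if $x_k$ does not occur in $g$; $\mathrm{true}$ if $g\in\mathrm{constraints}(M)$; $\mathrm{false}$ if $\lnot g\in\mathrm{constraints}(M)$; undefined otherwise. $g$ is compatible with $M$ if some $\beta\in\mathbb{F}_q$ makes the extension of $\nu_M$ by $x_k\mapsto\beta$ satisfy $g$ and all constraints on $M$. A clause $E$ is an explanation clause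 for $f$ in $M$ if no total assignment $\{x_1,\dots,x_n\}\to\mathbb{F}_q$ falsifies $E$, $f\in E$, and $\mathrm{value}(f',M)=\mathrm{false}$ for all $f'\in E$, $f'\neq f$. An explanation function maps each pair $(f,M)$ with $M$ a trail of level $k$, $f$ a constraint with polynomial in $\mathbb{F}_q[X_k]$, $f\notin\mathrm{constraints}(M)$ and $\lnot f$ not compatible with $M$, to an explanation clause for $f$ in $M$. *)

theory Defs
  imports "HOL-Library.Poly_Mapping"
begin

(* Polynomials in variables x_1, x_2, ... : finitely supported maps from
   exponent vectors to coefficients. *)
type_synonym 'a mpoly = "(nat \<Rightarrow>\<^sub>0 nat) \<Rightarrow>\<^sub>0 'a"

definition mpoly_vars :: "'a::zero mpoly \<Rightarrow> nat set" where
  "mpoly_vars p = (\<Union>m\<in>Poly_Mapping.keys p. Poly_Mapping.keys m)"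

definition mpoly_eval :: "(nat \<Rightarrow> 'a::comm_semiring_1) \<Rightarrow> 'a mpoly \<Rightarrow> 'a" where
  "mpoly_eval a p =
     (\<Sum>m\<in>Poly_Mapping.keys p.
        Poly_Mapping.lookup p m *
        (\<Prod>i\<in>Poly_Mapping.keys m. a i ^ Poly_Mapping.lookup m i))"

datatype 'p zero_constraint = EqZ 'p | NeqZ 'p

type_synonym 'a pconstraint = "'a mpoly zero_constraint"

fun neg :: "'a::zero pconstraint \<Rightarrow> 'a pconstraint" where
  "neg (EqZ p) = NeqZ p"
| "neg (NeqZ p) = EqZ p"

fun constraint_vars :: "'a::zero pconstraint \<Rightarrow> nat set" where
  "constraint_vars (EqZ p) = mpoly_vars p"
| "constraint_vars (NeqZ p) = mpoly_vars p"

fun holds :: "(nat \<Rightarrow> 'a::comm_semiring_1) \<Rightarrow> 'a pconstraint \<Rightarrow> bool" where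
  "holds a (EqZ p) \<longleftrightarrow> mpoly_eval a p = 0"
| "holds a (NeqZ p) \<longleftrightarrow> mpoly_eval a p \<noteq> 0"

(* Constraints whose polynomial lies in F[x_1, ..., x_k]. *)
definition constraints_over :: "nat \<Rightarrow> 'a::zero pconstraint set" where
  "constraints_over k = {g. constraint_vars g \<subseteq> {1..k}}"

(* Truth value under a partial assignment; None if some occurring variable is unassigned. *)
definition eval_partial :: "(nat \<rightharpoonup> 'a::comm_semiring_1) \<Rightarrow> 'a pconstraint \<Rightarrow> bool option" where
  "eval_partial \<nu> g =
     (if constraint_vars g \<subseteq> dom \<nu> then Some (holds (\<lambda>i. the (\<nu> i)) g) else None)"

datatype ('c, 'a) trail_elem = Constraint 'c | Assign nat 'a

type_synonym 'a trail = "('a pconstraint, 'a) trail_elem list"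

definition trail_constraints :: "'a::zero trail \<Rightarrow> 'a pconstraint set" where
  "trail_constraints M = {g. Constraint g \<in> set M}"

fun trail_assigns :: "'a::zero trail \<Rightarrow> (nat \<times> 'a) list" where
  "trail_assigns [] = []"
| "trail_assigns (Constraint g # M) = trail_assigns M"
| "trail_assigns (Assign i \<alpha> # M) = (i, \<alpha>) # trail_assigns M"

definition trail_assignment :: "'a::zero trail \<Rightarrow> (nat \<rightharpoonup> 'a)" where
  "trail_assignment M = map_of (trail_assigns M)"

(* A trail of level k assigns exactly x_1, ..., x_{k-1}, so k is determined by M. *)
definition trail_level :: "'a::zero trail \<Rightarrow> nat" where
  "trail_level M = Suc (length (trail_assigns M))"

definition is_trail :: "nat \<Rightarrow> 'a::zero trail \<Rightarrow> bool" where
  "is_trail n M \<longleftrightarrow>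
     trail_level M \<le> n \<and>
     map fst (trail_assigns M) = [1..<trail_level M] \<and>
     trail_constraints M \<subseteq> constraints_over (trail_level M)"

(* On constraints mentioning variables beyond x_k, which cannot occur on a trail of
   level k, the result is None. *)
definition trail_value :: "'a::comm_semiring_1 pconstraint \<Rightarrow> 'a trail \<Rightarrow> bool option" where
  "trail_value g M =
     (if trail_level M \<notin> constraint_vars g then eval_partial (trail_assignment M) g
      else if g \<in> trail_constraints M then Some True
      else if neg g \<in> trail_constraints M then Some False
      else None)"

definition compatible :: "'a::comm_semiring_1 pconstraint \<Rightarrow> 'a trail \<Rightarrow> bool" where
  "compatible g M \<longleftrightarrow>
     (\<exists>\<beta>. \<forall>h \<in> insert g (trail_constraints M).
        eval_partial ((trail_assignment M)(trail_level M \<mapsto> \<beta>)) h = Some True)"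

(* Clauses are arbitrary sets of constraints, read as disjunctions; the maps with
   domain {1..n} are the total assignments of x_1, ..., x_n. *)
definition falsifies :: "(nat \<rightharpoonup> 'a::comm_semiring_1) \<Rightarrow> 'a pconstraint set \<Rightarrow> bool" where
  "falsifies \<nu> E \<longleftrightarrow> (\<forall>g\<in>E. eval_partial \<nu> g = Some False)"

definition explanation_clause ::
    "nat \<Rightarrow> 'a::comm_semiring_1 pconstraint \<Rightarrow> 'a trail \<Rightarrow> 'a pconstraint set \<Rightarrow> bool" where
  "explanation_clause n f M E \<longleftrightarrow>
     E \<subseteq> constraints_over n \<and>
     \<not> (\<exists>\<nu>. dom \<nu> = {1..n} \<and> falsifies \<nu> E) \<and>
     f \<in> E \<and>
     (\<forall>g\<in>E. g \<noteq> f \<longrightarrow> trail_value g M = Some False)"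

definition explanation_inputs ::
    "nat \<Rightarrow> ('a::comm_semiring_1 pconstraint \<times> 'a trail) set" where
  "explanation_inputs n =
     {(f, M). is_trail n M \<and> f \<in> constraints_over (trail_level M) \<and>
              f \<notin> trail_constraints M \<and> \<not> compatible (neg f) M}"

(* The set D of inputs on which the function is defined is kept explicit.
   D = explanation_inputs n is the case of functions defined on every admissible pair.
   That case alone would be vacuous: on the trail consisting of the constraint 0 \<noteq> 0,
   the constraint x_1 = 0 is an admissible input without explanation clause.
   Smaller D cover, for instance, all inputs whose trail is satisfiable. *)
definition explanation_function_on ::
    "nat \<Rightarrow> ('a::comm_semiring_1 pconstraint \<times> 'a trail) set \<Rightarrow>
     ('a pconstraint \<Rightarrow> 'a trail \<Rightarrow> 'a pconstraint set) \<Rightarrow> bool" where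
  "explanation_function_on n D expl \<longleftrightarrow>
     D \<subseteq> explanation_inputs n \<and>
     (\<forall>(f, M)\<in>D. explanation_clause n f M (expl f M))"

end

theory Submission
  imports Defs
begin

text \<open>
  Since the field is finite, the constraints \<open>x\<^sub>i \<noteq> a\<close> form a finite set \<open>B\<close>. In an
  explanation clause for \<open>f\<close> in a trail of level \<open>k\<close>, every literal other than \<open>f\<close> that
  contains \<open>x\<^sub>k\<close> is the negation of a trail constraint, while every literal without \<open>x\<^sub>k\<close>
  is falsified by the trail assignment \<open>x\<^sub>i \<mapsto> \<alpha>\<^sub>i\<close> (\<open>i < k\<close>). Replacing the latter literals
  by all \<open>x\<^sub>i \<noteq> \<alpha>\<^sub>i\<close> keeps the clause valid: a total assignment falsifying the new clause
  extends the trail assignment, hence falsifies the old clause as well.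
\<close>

lemma mpoly_eval_cong:
  assumes "\<And>i. i \<in> mpoly_vars p \<Longrightarrow> a i = b i"
  shows "mpoly_eval a p = mpoly_eval b p"
proof -
  have "a i = b i" if "m \<in> Poly_Mapping.keys p" "i \<in> Poly_Mapping.keys m" for m i
    using assms that by (auto simp: mpoly_vars_def)
  then show ?thesis
    by (simp add: mpoly_eval_def)
qed

lemma holds_cong:
  assumes "\<And>i. i \<in> constraint_vars g \<Longrightarrow> a i = b i"
  shows "holds a g \<longleftrightarrow> holds b g"
  using assms by (cases g) (auto dest: mpoly_eval_cong)

text \<open>A defined value depends only on variables that are already assigned, so extending the
  assignment cannot change it. This carries falsity from the trail assignment to total
  assignments.\<close>

lemma eval_partial_map_le:
  assumes "\<nu> \<subseteq>\<^sub>m \<mu>" "eval_partial \<nu> g = Some b"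
  shows "eval_partial \<mu> g = Some b"
proof -
  have vars: "constraint_vars g \<subseteq> dom \<nu>"
    using assms(2) by (auto simp: eval_partial_def split: if_splits)
  moreover have "dom \<nu> \<subseteq> dom \<mu>"
    using assms(1) by (rule map_le_implies_dom_le)
  \<comment> \<open>\<open>the\<close> is unspecified outside the domain, so the two valuations are
    compared only on the variables of \<open>g\<close>, where \<open>\<nu>\<close> is
    defined.\<close>
  moreover have "holds (\<lambda>i. the (\<nu> i)) g \<longleftrightarrow> holds (\<lambda>i. the (\<mu> i)) g"
    using vars assms(1) by (intro holds_cong) (metis map_le_def subsetD)
  ultimately show ?thesis
    using assms(2) by (auto simp: eval_partial_def)
qed

text \<open>The linear polynomial x_i - a; the exponent vector \<open>0\<close> carries the constant
  term.\<close>

definition var_minus :: "nat \<Rightarrow> 'a::comm_ring_1 \<Rightarrow> 'a mpoly" where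
  "var_minus i a =
     Poly_Mapping.single (Poly_Mapping.single i 1) 1 + Poly_Mapping.single 0 (- a)"

text \<open>Only an inclusion: for \<open>a = 0\<close> the constant term vanishes and
  \<open>0\<close> is not a key.\<close>

lemma keys_var_minus: "Poly_Mapping.keys (var_minus i a) \<subseteq> {Poly_Mapping.single i 1, 0}"
  unfolding var_minus_def by (rule order_trans[OF Poly_Mapping.keys_add]) auto

lemma mpoly_vars_var_minus: "mpoly_vars (var_minus i a) \<subseteq> {i}"
  using keys_var_minus[of i a] by (fastforce simp: mpoly_vars_def)

lemma mpoly_eval_var_minus: "mpoly_eval v (var_minus i a) = v i - a"
proof -
  let ?m = "Poly_Mapping.single i (1::nat)"
  \<comment> \<open>Distinctness of the two monomials lets the sum over \<open>{?m, 0}\<close> split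
    into two terms.\<close>
  have ne: "?m \<noteq> 0"
    by (metis lookup_single_eq lookup_zero zero_neq_one)
  have "mpoly_eval v (var_minus i a) =
      (\<Sum>m\<in>{?m, 0}. Poly_Mapping.lookup (var_minus i a) m *
        (\<Prod>j\<in>Poly_Mapping.keys m. v j ^ Poly_Mapping.lookup m j))"
    unfolding mpoly_eval_def using keys_var_minus[of i a]
    by (intro sum.mono_neutral_left) (auto simp: in_keys_iff)
  also have "\<dots> = v i - a"
    using ne by (simp add: var_minus_def lookup_add lookup_single when_def)
  finally show ?thesis .
qed

abbreviation var_neq :: "nat \<Rightarrow> 'a::comm_ring_1 \<Rightarrow> 'a pconstraint" where
  "var_neq i a \<equiv> NeqZ (var_minus i a)"

lemma var_neq_over:
  "(\<lambda>(i, a). var_neq i a) ` ({1..n} \<times> UNIV) \<subseteq> constraints_over n"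
  using mpoly_vars_var_minus by (fastforce simp: constraints_over_def)

lemma eval_partial_var_neq:
  "\<nu> i = Some b \<Longrightarrow> eval_partial \<nu> (var_neq i a) = Some (b \<noteq> a)"
  using mpoly_vars_var_minus[of i a] by (auto simp: eval_partial_def mpoly_eval_var_minus)

lemma dom_trail_assignment:
  assumes "is_trail n M"
  shows "dom (trail_assignment M) = {1..<trail_level M}"
proof -
  have "dom (trail_assignment M) = set (map fst (trail_assigns M))"
    by (simp add: trail_assignment_def dom_map_of_conv_image_fst)
  with assms show ?thesis by (simp add: is_trail_def)
qed

lemma neg_neg [simp]: "neg (neg g) = g"
  by (cases g) auto

text \<open>A total assignment falsifies all of these literals exactly when it extends the trail
  assignment.\<close>

definition assignment_literals :: "'a::comm_ring_1 trail \<Rightarrow> 'a pconstraint set" where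
  "assignment_literals M = {var_neq i a | i a. trail_assignment M i = Some a}"

text \<open>\<open>f\<close> is inserted separately because it need not contain the variable of the
  trail level, in which case the filter on \<open>E\<close> would drop it.\<close>

definition basis_clause ::
    "'a::comm_ring_1 pconstraint \<Rightarrow> 'a trail \<Rightarrow> 'a pconstraint set \<Rightarrow> 'a pconstraint set" where
  "basis_clause f M E =
     insert f (assignment_literals M \<union> {g \<in> E. trail_level M \<in> constraint_vars g})"

lemma assignment_literals_subset:
  assumes "is_trail n M"
  shows "assignment_literals M \<subseteq> (\<lambda>(i, a). var_neq i a) ` ({1..n} \<times> UNIV)"
proof
  fix g assume "g \<in> assignment_literals M"
  then obtain i a where g: "g = var_neq i a" and i: "i \<in> dom (trail_assignment M)"
    by (auto simp: assignment_literals_def)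
  have "i \<in> {1..n}"
    using i assms unfolding dom_trail_assignment[OF assms] by (auto simp: is_trail_def)
  with g show "g \<in> (\<lambda>(i, a). var_neq i a) ` ({1..n} \<times> UNIV)" by force
qed

lemma trail_value_assignment_literal:
  assumes "is_trail n M" "g \<in> assignment_literals M"
  shows "trail_value g M = Some False"
proof -
  obtain i a where g: "g = var_neq i a" and i: "trail_assignment M i = Some a"
    using assms(2) by (auto simp: assignment_literals_def)
  \<comment> \<open>Strictness matters: the literal avoids the top variable, so
    \<open>trail_value\<close> is computed by \<open>eval_partial\<close>.\<close>
  have "i < trail_level M"
    using dom_trail_assignment[OF assms(1)] i by auto
  then have "trail_level M \<notin> constraint_vars g"
    using mpoly_vars_var_minus[of i a] g by auto
  then show ?thesis
    using eval_partial_var_neq[of "trail_assignment M", OF i] g by (simp add: trail_value_def)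
qed

lemma explanation_clause_basis_clause:
  assumes trail: "is_trail n M" and E: "explanation_clause n f M E"
  shows "explanation_clause n f M (basis_clause f M E)"
  unfolding explanation_clause_def
proof (intro conjI ballI impI notI)
  show "basis_clause f M E \<subseteq> constraints_over n"
    using E order_trans[OF assignment_literals_subset[OF trail] var_neq_over]
    by (auto simp: basis_clause_def explanation_clause_def)
  show "f \<in> basis_clause f M E"
    by (simp add: basis_clause_def)
next
  fix g assume "g \<in> basis_clause f M E" "g \<noteq> f"
  then show "trail_value g M = Some False"
    using E trail_value_assignment_literal[OF trail]
    by (auto simp: basis_clause_def explanation_clause_def)
next
  assume "\<exists>\<nu>. dom \<nu> = {1..n} \<and> falsifies \<nu> (basis_clause f M E)"
  then obtain \<nu> where dom: "dom \<nu> = {1..n}" and fals: "falsifies \<nu> (basis_clause f M E)"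
    by blast
  have le: "trail_assignment M \<subseteq>\<^sub>m \<nu>"
    unfolding map_le_def
  proof
    fix i assume i: "i \<in> dom (trail_assignment M)"
    then obtain a where a: "trail_assignment M i = Some a" by blast
    have "i \<in> dom \<nu>"
      using i trail unfolding dom dom_trail_assignment[OF trail] by (auto simp: is_trail_def)
    then obtain b where b: "\<nu> i = Some b" by blast
    have "var_neq i a \<in> basis_clause f M E"
      using a by (auto simp: basis_clause_def assignment_literals_def)
    then have "eval_partial \<nu> (var_neq i a) = Some False"
      using fals by (auto simp: falsifies_def)
    \<comment> \<open>The literal evaluates to \<open>b \<noteq> a\<close>, so its falsity forces
      \<open>b = a\<close>.\<close>
    then show "trail_assignment M i = \<nu> i"
      using a b eval_partial_var_neq[of \<nu>, OF b] by simp
  qed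
  have "eval_partial \<nu> g = Some False" if "g \<in> E" for g
  \<comment> \<open>The first case covers the literals of \<open>E\<close> kept in the new clause;
    the others were dropped, and their falsity comes from the trail assignment.\<close>
  proof (cases "g = f \<or> trail_level M \<in> constraint_vars g")
    case True
    with that fals show ?thesis by (auto simp: falsifies_def basis_clause_def)
  next
    case False
    with that E have "eval_partial (trail_assignment M) g = Some False"
      by (auto simp: explanation_clause_def trail_value_def)
    with le show ?thesis by (rule eval_partial_map_le)
  qed
  then have "falsifies \<nu> E"
    by (simp add: falsifies_def)
  with dom E show False
    unfolding explanation_clause_def by blast
qed

text \<open>For a literal containing the top variable, \<open>trail_value\<close> can be
  \<open>Some False\<close> only because its negation is on the trail; such literals are exempt from
  the basis.\<close>

lemma basis_clause_literal:
  assumes E: "explanation_clause n f M E"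
    and g: "g \<in> basis_clause f M E" "g \<noteq> f" "g \<notin> neg ` trail_constraints M"
  shows "g \<in> assignment_literals M"
proof (rule ccontr)
  assume "g \<notin> assignment_literals M"
  with g E have "trail_level M \<in> constraint_vars g" "trail_value g M = Some False"
    by (auto simp: basis_clause_def explanation_clause_def)
  then have "neg g \<in> trail_constraints M"
    by (auto simp: trail_value_def split: if_splits)
  then have "neg (neg g) \<in> neg ` trail_constraints M"
    by (rule imageI)
  with g(3) show False by simp
qed

theorem theorem2:
  fixes n :: nat
  assumes "n \<ge> 1"
  shows "\<exists>B :: 'a::{field,finite} pconstraint set.
           finite B \<and> B \<subseteq> constraints_over n \<and>
           (\<forall>D expl. explanation_function_on n D expl \<longrightarrow>
              (\<exists>expl'. explanation_function_on n D expl' \<and>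
                 (\<forall>(f, M)\<in>D. \<forall>g \<in> expl' f M.
                    g \<noteq> f \<longrightarrow> g \<notin> neg ` trail_constraints M \<longrightarrow> g \<in> B)))"
proof -
  \<comment> \<open>Chosen before \<open>D\<close> and \<open>expl\<close>, and finite because the
    field is.\<close>
  let ?B = "(\<lambda>(i, a). var_neq i a) ` ({1..n} \<times> UNIV) :: 'a pconstraint set"
  have "\<exists>expl'. explanation_function_on n D expl' \<and>
          (\<forall>(f, M)\<in>D. \<forall>g \<in> expl' f M.
             g \<noteq> f \<longrightarrow> g \<notin> neg ` trail_constraints M \<longrightarrow> g \<in> ?B)"
    if expl: "explanation_function_on n D expl"
    for D and expl :: "'a pconstraint \<Rightarrow> 'a trail \<Rightarrow> 'a pconstraint set"
  proof -
    let ?expl' = "\<lambda>f M. basis_clause f M (expl f M)"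
    have D: "D \<subseteq> explanation_inputs n"
      using expl by (simp add: explanation_function_on_def)
    have input: "is_trail n M" "explanation_clause n f M (expl f M)" if "(f, M) \<in> D" for f M
      using that D expl by (auto simp: explanation_function_on_def explanation_inputs_def)
    have "explanation_function_on n D ?expl'"
      unfolding explanation_function_on_def
      using D input explanation_clause_basis_clause by blast
    moreover have "g \<in> ?B"
      if "(f, M) \<in> D" "g \<in> ?expl' f M" "g \<noteq> f" "g \<notin> neg ` trail_constraints M" for f M g
      using basis_clause_literal[OF input(2)[OF that(1)] that(2-4)]
        assignment_literals_subset[OF input(1)[OF that(1)]] by blast
    ultimately show ?thesis
      by (intro exI[of _ ?expl']) blast
  qed
  moreover have "?B \<subseteq> constraints_over n"
    by (rule var_neq_over)
  moreover have "finite ?B"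
    by simp
  ultimately show ?thesis
    by (intro exI[of _ ?B]) blast
qed

end
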